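(* Let $q\in\mathbb{C}$ with $0<|q|<1$, and let $a,b,c,d,e$ be complex numbers such that at least one of $a$, $b$, $c$ is of the form $q^n$ with $n\in\{1,2,\ldots\}$ (and such that all terms below are well defined). Then \[ \sum_{k=-\infty}^\infty \frac{(q/a,q/b,q/c,q/d,q/e)_k}{(a,b,c,d/q,e/q)_k}(abcdeq^{-3})^k =\frac{(q,ab/q,bc/q,ac/q)_\infty}{(a,b,c,abc/q^2)_\infty} \sum_{k=0}^\infty\frac{(q/a,q/b,q/c,de/q^2)_k}{(q,q^3/abc,d,e)_k}q^k, \] and \[ \sum_{k=-\infty}^\infty \frac{(q/a,q/b,q/c,q/d,q/e)_k}{(a,b,c,d/q,e/q)_k}(abcdeq^{-4})^k =\frac{(q,ab/q,bc/q,ac/q)_\infty}{(a,b,c,abc/q^2)_\infty} \sum_{k=0}^\infty\frac{(q/a,q/b,q/c,de/q^2)_k}{(q,q^3/abc,d,e)_k}q^{2k}. \]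
   Context: For an integer $n$, the $q$-shifted factorial is $(a)_n=(a;q)_n$ with $(a)_0=1$, $(a)_n=(1-a)(1-aq)\cdots(1-aq^{n-1})$ for $n\ge1$, and $(a)_n=[(1-aq^{-1})(1-aq^{-2})\cdots(1-aq^{n})]^{-1}$ for $n\le -1$. Also $(a_1,\ldots,a_m)_n=(a_1)_n\cdots(a_m)_n$ and $(a_1,\ldots,a_m)_\infty=\lim_{n\to\infty}(a_1,\ldots,a_m)_n$. *)

theory Defs
  imports "HOL-Analysis.Analysis"
begin

definition qpoch :: "complex \<Rightarrow> complex \<Rightarrow> int \<Rightarrow> complex" where
  "qpoch q a n =
     (if n \<ge> 0 then (\<Prod>j<nat n. (1 - a * q ^ j))
      else inverse (\<Prod>j\<in>{1..nat (- n)}. (1 - a / q ^ j)))"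

definition qpoch_inf :: "complex \<Rightarrow> complex \<Rightarrow> complex" where
  "qpoch_inf q a = (\<Prod>j. (1 - a * q ^ j))"

end

(* If, say, a = q^(n+1), both sums are finite and the quotient of infinite products is a quotient
   of finite ones. The identity is then Bailey's lemma relative to 1. With
   K(j,k) = 1/((q)_(j-k) (q)_(j+k)), terms k and -k taken together, and
   U_k(b,c) = (bc/q)^k (q/b, q/c)_k / (b,c)_k, the q-Saalschuetz sum turns
   sum_k alpha_k K(j,k) = beta_j into an evaluation of sum_k alpha_k U_k(b,c) K(n,k).
   Applied to the unit Bailey pair (beta_j = [j = 0]) it yields the pair
   alpha_k U_k(d,e), beta_j = (de/q)_j / (q,d,e)_j. The terms of the theorem carry d/q and e/q
   instead of d and e; after adding the terms k and -k this is an extra factor that is affine in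
   x = q^k + q^(-k), and since q^j x K(j,k) = (1 + q^(2j)) K(j,k) - K(j-1,k), the new beta_j is a
   combination of the old beta_j and beta_(j-1). Bailey's lemma with parameters b, c then gives
   the theorem. *)
theory Submission
  imports Defs
begin

section \<open>Finite q-shifted factorials with natural index\<close>

definition qp :: "complex \<Rightarrow> complex \<Rightarrow> nat \<Rightarrow> complex" where
  "qp q a n = (\<Prod>j<n. 1 - a * q ^ j)"

lemma qp_0 [simp]: "qp q a 0 = 1"
  by (simp add: qp_def)

lemma qp_Suc: "qp q a (Suc n) = qp q a n * (1 - a * q ^ n)"
  by (simp add: qp_def)

lemma qp_add: "qp q a (m + n) = qp q a m * qp q (a * q ^ m) n"
  by (induction n) (simp_all add: qp_Suc power_add mult_ac)

lemma qp_Suc_left: "qp q a (Suc n) = (1 - a) * qp q (a * q) n"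
  using qp_add[of q a 1 n] by (simp add: qp_Suc)

lemma qpoch_nat: "qpoch q a (int n) = qp q a n"
  by (simp add: qpoch_def qp_def)

lemma qpoch_neg: "qpoch q a (- int n) = inverse (\<Prod>i<n. 1 - a / q ^ Suc i)"
  by (cases "n = 0") (simp_all add: qpoch_def prod.atLeast1_atMost_eq)

text \<open>The top k factors of (x)_n are turned around by 1 - y = -y (1 - 1/y) with y = x
  q^(n-1-i). Collecting the powers of q on the left keeps all exponents natural.\<close>

lemma qp_reverse:
  assumes "q \<noteq> 0" "x \<noteq> 0" "k \<le> n"
  shows "qp q x n * q ^ (k choose 2) * q ^ k
    = qp q x (n - k) * (- x * q ^ n) ^ k * qp q (q / (x * q ^ n)) k"
  using assms(3)
proof (induction k)
  case (Suc k)
  then obtain m where n: "n = Suc (m + k)"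
    by (metis add.commute add_Suc_right le_Suc_ex)
  have IH: "qp q x n * q ^ (k choose 2) * q ^ k
    = qp q x (Suc m) * (- x * q ^ n) ^ k * qp q (q / (x * q ^ n)) k"
    using Suc n by simp
  have "qp q x n * q ^ (Suc k choose 2) * q ^ Suc k
     = (qp q x n * q ^ (k choose 2) * q ^ k) * q ^ Suc k"
    by (simp add: numeral_2_eq_2 power_add mult_ac)
  also have "\<dots> = qp q x m * (- x * q ^ n) ^ k * qp q (q / (x * q ^ n)) k
      * ((1 - x * q ^ m) * q ^ Suc k)"
    unfolding IH qp_Suc by (simp only: mult_ac)
  also have "(1 - x * q ^ m) * q ^ Suc k = (- x * q ^ n) * (1 - q / (x * q ^ n) * q ^ k)"
    using assms(1,2) by (simp add: n power_add field_simps)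
  finally show ?case
    by (simp add: n qp_Suc mult_ac)
qed (simp add: numeral_2_eq_2)

text \<open>The denominators may vanish: they do so simultaneously on both sides, where
  division by zero gives \<open>0\<close> twice.\<close>

lemma qp_neg_ratio:
  assumes "q \<noteq> 0" "x \<noteq> 0"
  shows "(\<Prod>i<k. 1 - x / q ^ Suc i) / (\<Prod>i<k. 1 - (q / x) / q ^ Suc i)
     = (x\<^sup>2 / q) ^ k * qp q (q / x) k / qp q x k"
proof (induction k)
  case (Suc k)
  have step: "(1 - x / q ^ Suc k) / (1 - (q / x) / q ^ Suc k)
      = (x\<^sup>2 / q) * (1 - (q / x) * q ^ k) / (1 - x * q ^ k)"
  proof (cases "x * q ^ k = 1")
    case True
    then have "(q / x) / q ^ Suc k = 1"
      using assms by (simp add: field_simps)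
    with True show ?thesis by simp
  next
    case False
    then have "1 - (q / x) / q ^ Suc k \<noteq> 0"
      using assms by (simp add: field_simps)
    with False assms show ?thesis
      by (simp add: divide_simps) (simp add: algebra_simps power2_eq_square)
  qed
  have "(\<Prod>i<Suc k. 1 - x / q ^ Suc i) / (\<Prod>i<Suc k. 1 - (q / x) / q ^ Suc i)
    = ((\<Prod>i<k. 1 - x / q ^ Suc i) / (\<Prod>i<k. 1 - (q / x) / q ^ Suc i))
     * ((1 - x / q ^ Suc k) / (1 - (q / x) / q ^ Suc k))"
    by (simp del: power_Suc)
  also have "\<dots> = (x\<^sup>2 / q) ^ Suc k * qp q (q / x) (Suc k) / qp q x (Suc k)"
    unfolding Suc.IH step qp_Suc by (simp add: mult_ac)
  finally show ?case .
qed simp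

section \<open>The q-Saalschuetz sum\<close>

lemma saalschutz_certificate:
  fixes u q y z A B D :: complex
  shows "(1 - q * (y * z)) * (1 - A * B * D * (y * z)) * (u * (1 - D * z))
      - (1 - A * D * (y * z)) * (1 - B * D * (y * z)) * (u * (1 - q * z))
    = - z * (u * (1 - q * z) * D * (1 - A * y) * (1 - B * y))
      - - z * (1 - y) * (q - A * B * D * y) * (u * (1 - D * z))"
  by algebra

text \<open>The terminating parameter q^(-m) and its companion q^(1-m)/D of the balanced 3phi2
  series are reversed into the factors at m - s, so that no negative powers occur. The proof is a
  Wilf-Zeilberger induction on m.\<close>

lemma q_saalschutz:
  assumes q: "\<And>k. qp q q k \<noteq> 0" and C: "\<And>k. qp q (A * B * D) k \<noteq> 0" and q0: "q \<noteq> 0"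
  shows "(\<Sum>s\<le>m. qp q A s * qp q B s * qp q D (m - s) * D ^ s
            / (qp q q s * qp q q (m - s) * qp q (A * B * D) s))
      = qp q (A * D) m * qp q (B * D) m / (qp q q m * qp q (A * B * D) m)"
proof (induction m)
  case (Suc m)
  define C where "C = A * B * D"
  define f where "f m s = qp q A s * qp q B s * qp q D (m - s) * D ^ s
            / (qp q q s * qp q q (m - s) * qp q C s)" for m s
  \<comment> \<open>\<open>G\<close> is the companion of \<open>f\<close>: \<open>r\<close> and
    \<open>t\<close> are the denominator and the numerator of the quotient of the closed forms at m
    + 1 and m, and r f(m+1,s) - t f(m,s) is a difference in s.\<close>
  define G where "G s = - (q ^ (m + 1 - s)) * (1 - q ^ s) * (1 - C * q ^ s / q) * f (Suc m) s" for s
  define r where "r = (1 - q ^ Suc m) * (1 - C * q ^ m)"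
  define t where "t = (1 - A * D * q ^ m) * (1 - B * D * q ^ m)"
  have nz: "1 - q ^ Suc k \<noteq> 0" "1 - C * q ^ k \<noteq> 0" for k
    using q[of "Suc k"] C[of "Suc k"] by (auto simp: qp_Suc C_def)
  have step: "r * f (Suc m) s - t * f m s = G (Suc s) - G s" if "s \<le> m" for s
  proof -
    obtain i where m: "m = s + i" using le_Suc_ex[OF \<open>s \<le> m\<close>] by blast
    define u where "u = qp q A s * qp q B s * qp q D i * D ^ s / (qp q q s * qp q q (Suc i) * qp q C s)"
    have f1: "f (Suc m) s = u * (1 - D * q ^ i)"
      by (simp add: f_def u_def m qp_Suc Suc_diff_le)
    have f2: "f m s = u * (1 - q ^ Suc i)"
      using nz[of i] by (simp add: f_def u_def m qp_Suc) (simp only: mult_ac)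
    have f3: "f (Suc m) (Suc s) * ((1 - q ^ Suc s) * (1 - C * q ^ s))
        = u * (1 - q ^ Suc i) * D * (1 - A * q ^ s) * (1 - B * q ^ s)"
      using nz[of s] nz[of i] by (simp add: f_def u_def m qp_Suc)
    have "G (Suc s) = - (q ^ i) * (f (Suc m) (Suc s) * ((1 - q ^ Suc s) * (1 - C * q ^ s)))"
      using q0 by (simp add: G_def m)
    then have G1: "G (Suc s) = - (q ^ i) * (u * (1 - q ^ Suc i) * D * (1 - A * q ^ s) * (1 - B * q ^ s))"
      by (simp only: f3)
    have G2: "G s = - (q ^ i) * (1 - q ^ s) * (q - C * q ^ s) * (u * (1 - D * q ^ i))"
    proof -
      have "G s = - (q ^ (m + 1 - s) * (1 - C * q ^ s / q)) * ((1 - q ^ s) * f (Suc m) s)"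
        by (simp only: G_def mult_minus_left mult_ac)
      also have "q ^ (m + 1 - s) * (1 - C * q ^ s / q) = q ^ i * (q - C * q ^ s)"
        using q0 by (simp add: m right_diff_distrib)
      finally show ?thesis
        unfolding f1 by (simp add: mult_ac)
    qed
    \<comment> \<open>All four terms are multiples of \<open>u\<close>; with y = q^s and z = q^i the
      claim is polynomial.\<close>
    show ?thesis
      unfolding f1 f2 G1 G2 r_def t_def
      unfolding m power_add power_Suc C_def by (rule saalschutz_certificate)
  qed
  \<comment> \<open>The index s = m + 1 has no counterpart in \<open>f m\<close>; its term cancels
    the upper end of the telescoping sum.\<close>
  have last: "r * f (Suc m) (Suc m) = - G (Suc m)"
    using q0 by (simp add: G_def r_def algebra_simps)
  have "r * (\<Sum>s\<le>Suc m. f (Suc m) s) - t * (\<Sum>s\<le>m. f m s)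
      = (\<Sum>s\<le>m. r * f (Suc m) s - t * f m s) - G (Suc m)"
    by (simp add: sum_subtractf sum_distrib_left ring_distribs last)
  also have "(\<Sum>s\<le>m. r * f (Suc m) s - t * f m s) = (\<Sum>s<Suc m. G (Suc s) - G s)"
    by (simp add: step lessThan_Suc_atMost)
  also have "\<dots> = G (Suc m) - G 0"
    by (rule sum_lessThan_telescope)
  also have "G 0 = 0"
    by (simp add: G_def)
  finally have "r * (\<Sum>s\<le>Suc m. f (Suc m) s) = t * (\<Sum>s\<le>m. f m s)"
    by simp
  also have "(\<Sum>s\<le>m. f m s) = qp q (A * D) m * qp q (B * D) m / (qp q q m * qp q C m)"
    using Suc.IH by (simp add: f_def C_def)
  finally have "r * (\<Sum>s\<le>Suc m. f (Suc m) s)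
     = t * (qp q (A * D) m * qp q (B * D) m / (qp q q m * qp q C m))" .
  moreover have "r \<noteq> 0"
    using nz[of m] by (simp add: r_def)
  ultimately have "(\<Sum>s\<le>Suc m. f (Suc m) s)
     = t * (qp q (A * D) m * qp q (B * D) m / (qp q q m * qp q C m)) / r"
    by (metis nonzero_mult_div_cancel_left)
  also have "\<dots> = qp q (A * D) (Suc m) * qp q (B * D) (Suc m) / (qp q q (Suc m) * qp q C (Suc m))"
    by (simp add: r_def t_def qp_Suc mult_ac)
  finally show ?case
    by (simp add: f_def C_def)
qed simp

section \<open>Bailey's lemma relative to 1\<close>

definition kern :: "complex \<Rightarrow> nat \<Rightarrow> nat \<Rightarrow> complex" where
  "kern q j k = 1 / (qp q q (j - k) * qp q q (j + k))"

definition well_poised :: "complex \<Rightarrow> complex \<Rightarrow> complex \<Rightarrow> nat \<Rightarrow> complex" where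
  "well_poised q b c k = (b * c / q) ^ k * qp q (q / b) k * qp q (q / c) k / (qp q b k * qp q c k)"

text \<open>Up to the factor 1/((b)_n (c)_n), the weight with which Bailey's lemma lets beta_j enter
  the new beta_n.\<close>

definition saal_coeff :: "complex \<Rightarrow> complex \<Rightarrow> complex \<Rightarrow> nat \<Rightarrow> nat \<Rightarrow> complex" where
  "saal_coeff q b c n j = qp q (q / b) j * qp q (q / c) j * qp q (b * c / q) (n - j) * (b * c / q) ^ j
     / qp q q (n - j)"

text \<open>With j = k + s this is q-Saalschuetz for A = q^(k+1)/b, B = q^(k+1)/c, D = bc/q, times a
  factor free of s. Here A B D = q^(2k+1), and (q)_(2k+i) = (q)_(2k) (q^(2k+1))_i links its
  denominators to the kernel.\<close>

lemma kern_saalschutz: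
  assumes q: "\<And>k. qp q q k \<noteq> 0" "q \<noteq> 0"
    and b: "b \<noteq> 0" "\<And>k. qp q b k \<noteq> 0" and c: "c \<noteq> 0" "\<And>k. qp q c k \<noteq> 0"
    and "k \<le> n"
  shows "(\<Sum>j = k..n. saal_coeff q b c n j * kern q j k) = qp q b n * qp q c n * (well_poised q b c k * kern q n k)"
proof -
  obtain m where n: "n = k + m" using le_Suc_ex[OF \<open>k \<le> n\<close>] by blast
  define A B D where "A = q / b * q ^ k" and "B = q / c * q ^ k" and "D = b * c / q"
  have C: "A * B * D = q * q ^ (k + k)" and AD: "A * D = c * q ^ k" and BD: "B * D = b * q ^ k"
    using q b c by (simp_all add: A_def B_def D_def power_add)
  have qC: "qp q q (k + k + i) = qp q q (k + k) * qp q (A * B * D) i" for i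
    by (simp only: qp_add C)
  have Cnz: "qp q (A * B * D) i \<noteq> 0" for i
    using q(1)[of "k + k + i"] by (simp add: qC)
  let ?M = "qp q (q / b) k * qp q (q / c) k * D ^ k / qp q q (k + k)"
  have "(\<Sum>j = k..n. saal_coeff q b c n j * kern q j k) = (\<Sum>s\<le>m. saal_coeff q b c n (k + s) * kern q (k + s) k)"
    by (rule sum.reindex_bij_witness[of _ "\<lambda>s. k + s" "\<lambda>j. j - k"]) (auto simp: n)
  also have "\<dots> = (\<Sum>s\<le>m. ?M * (qp q A s * qp q B s * qp q D (m - s) * D ^ s
            / (qp q q s * qp q q (m - s) * qp q (A * B * D) s)))"
  proof (rule sum.cong[OF refl])
    fix s
    have "k + s + k = k + k + s" by simp
    then have "kern q (k + s) k = 1 / (qp q q s * (qp q q (k + k) * qp q (A * B * D) s))"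
      by (simp only: kern_def qC diff_add_inverse)
    then show "saal_coeff q b c n (k + s) * kern q (k + s) k
      = ?M * (qp q A s * qp q B s * qp q D (m - s) * D ^ s
            / (qp q q s * qp q q (m - s) * qp q (A * B * D) s))"
      unfolding saal_coeff_def D_def[symmetric] qp_add[of q "q / b"] qp_add[of q "q / c"]
        A_def[symmetric] B_def[symmetric]
      by (simp add: n power_add) (simp only: mult_ac)
  qed
  also have "\<dots> = ?M * (qp q (A * D) m * qp q (B * D) m / (qp q q m * qp q (A * B * D) m))"
    by (simp only: sum_distrib_left[symmetric] q_saalschutz[OF q(1) Cnz q(2)])
  also have "\<dots> = qp q b n * qp q c n * (well_poised q b c k * kern q n k)"
  proof -
    have nk: "n + k = k + k + m" "n - k = m" using n by simp_all
    have "qp q b n = qp q b k * qp q (B * D) m" "qp q c n = qp q c k * qp q (A * D) m"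
      by (simp_all add: n qp_add AD BD)
    then show ?thesis
      unfolding well_poised_def kern_def nk D_def[symmetric] using b(2)[of k] c(2)[of k] by (simp add: qC) (simp only: mult_ac)
  qed
  finally show ?thesis .
qed

text \<open>Inserting the pair and exchanging the sums over k <= j <= n leaves an inner sum over j
  that \<open>kern_saalschutz\<close> evaluates.\<close>

lemma bailey_lemma:
  assumes q: "\<And>k. qp q q k \<noteq> 0" "q \<noteq> 0"
    and b: "b \<noteq> 0" "\<And>k. qp q b k \<noteq> 0" and c: "c \<noteq> 0" "\<And>k. qp q c k \<noteq> 0"
    and pair: "\<And>j. j \<le> n \<Longrightarrow> (\<Sum>k\<le>j. \<alpha> k * kern q j k) = \<beta> j"
  shows "qp q b n * qp q c n * (\<Sum>k\<le>n. \<alpha> k * well_poised q b c k * kern q n k) = (\<Sum>j\<le>n. saal_coeff q b c n j * \<beta> j)"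
proof -
  have "(\<Sum>j\<le>n. saal_coeff q b c n j * \<beta> j) = (\<Sum>j\<le>n. \<Sum>k | k \<in> {..n} \<and> k \<le> j. saal_coeff q b c n j * (\<alpha> k * kern q j k))"
  proof (rule sum.cong[OF refl])
    fix j assume "j \<in> {..n}"
    then have "{k. k \<in> {..n} \<and> k \<le> j} = {..j}" by auto
    with \<open>j \<in> {..n}\<close> show "saal_coeff q b c n j * \<beta> j
        = (\<Sum>k | k \<in> {..n} \<and> k \<le> j. saal_coeff q b c n j * (\<alpha> k * kern q j k))"
      by (simp add: pair[symmetric] sum_distrib_left)
  qed
  also have "\<dots> = (\<Sum>k\<le>n. \<Sum>j | j \<in> {..n} \<and> k \<le> j. saal_coeff q b c n j * (\<alpha> k * kern q j k))"
    by (rule sum.swap_restrict) simp_all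
  also have "\<dots> = (\<Sum>k\<le>n. \<alpha> k * (qp q b n * qp q c n * (well_poised q b c k * kern q n k)))"
  proof (rule sum.cong[OF refl])
    fix k assume "k \<in> {..n}"
    moreover have "{j. j \<in> {..n} \<and> k \<le> j} = {k..n}" by auto
    ultimately show "(\<Sum>j | j \<in> {..n} \<and> k \<le> j. saal_coeff q b c n j * (\<alpha> k * kern q j k))
        = \<alpha> k * (qp q b n * qp q c n * (well_poised q b c k * kern q n k))"
      using kern_saalschutz[OF q b c, of k n] by (simp add: sum_distrib_left mult_ac flip: sum_distrib_left)
  qed
  also have "\<dots> = qp q b n * qp q c n * (\<Sum>k\<le>n. \<alpha> k * well_poised q b c k * kern q n k)"
    by (simp add: sum_distrib_left mult_ac)
  finally show ?thesis by simp
qed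

section \<open>The unit Bailey pair and the pairs with parameters d and e\<close>

text \<open>Here and below the entry at \<^term>\<open>k > 0\<close> of a sequence paired with the kernel
  is the sum of the entries at \<open>k\<close> and \<open>- k\<close> of a bilateral sequence.\<close>

definition unit_pair :: "complex \<Rightarrow> nat \<Rightarrow> complex" where
  "unit_pair q k = (if k = 0 then 1 else (1 + q ^ k) * (- 1) ^ k * q ^ (k choose 2))"

lemma choose2_Suc: "Suc k choose 2 = k + (k choose 2)"
  by (simp add: numeral_2_eq_2)

text \<open>For j > 0, every partial sum that stops before k = j has, up to the factor 1 - q^j, the
  closed form \<open>partial\<close>; the term k = j then cancels the last of them.\<close>

lemma unit_bailey_pair:
  assumes q: "\<And>k. qp q q k \<noteq> 0"
  shows "(\<Sum>k\<le>j. unit_pair q k * kern q j k) = (if j = 0 then 1 else 0)"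
proof (cases j)
  case (Suc i)
  have nz: "1 - q ^ Suc k \<noteq> 0" for k
    using q[of "Suc k"] by (simp add: qp_Suc)
  \<comment> \<open>The case m = j is excluded: there truncated subtraction would give 1/(q)_0 = 1
    in place of 1/(q)_(-1) = 0.\<close>
  have partial: "(\<Sum>k\<le>m. unit_pair q k * kern q j k) * (1 - q ^ j)
      = (- 1) ^ m * q ^ (Suc m choose 2) / (qp q q (j - Suc m) * qp q q (j + m))" if "m < j" for m
    using that
  proof (induction m)
    case 0
    then show ?case
      using nz[of i] by (simp add: unit_pair_def kern_def Suc qp_Suc numeral_2_eq_2)
  next
    case (Suc m)
    then obtain l where j: "j = Suc (Suc m) + l"
      by (metis less_imp_Suc_add add_Suc_right add_Suc add.commute)
    define Q where "Q = qp q q l * qp q q (j + m)"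
    define w where "w = (- 1) ^ m * q ^ (Suc m choose 2) / (Q * (1 - q ^ Suc l) * (1 - q ^ Suc (j + m)))"
    have IH: "(\<Sum>k\<le>m. unit_pair q k * kern q j k) * (1 - q ^ j) = w * (1 - q ^ Suc (j + m))"
      using Suc nz[of "j + m"] by (simp add: j qp_Suc w_def Q_def)
    have new: "unit_pair q (Suc m) * kern q j (Suc m) = - w * (1 + q ^ Suc m)"
      using nz[of l] nz[of "j + m"]
      by (simp add: unit_pair_def kern_def w_def Q_def j qp_Suc) (simp only: mult_ac)
    have "(- 1) ^ Suc m * q ^ (Suc (Suc m) choose 2) / (qp q q (j - Suc (Suc m)) * qp q q (j + Suc m))
       = - w * q ^ Suc m * (1 - q ^ Suc l)"
      using nz[of l] unfolding w_def Q_def choose2_Suc[of "Suc m"] power_add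
      by (simp add: j qp_Suc) (simp only: mult_ac)
    moreover have "w * (1 - q ^ Suc (j + m)) + (- w * (1 + q ^ Suc m)) * (1 - q ^ j)
       = - w * q ^ Suc m * (1 - q ^ Suc l)"
      unfolding j power_add power_Suc by algebra
    ultimately show ?case
      unfolding sum.atMost_Suc ring_distribs(2) IH new by simp
  qed
  have "(\<Sum>k\<le>j. unit_pair q k * kern q j k) * (1 - q ^ j) =
      (\<Sum>k\<le>i. unit_pair q k * kern q j k) * (1 - q ^ j) + unit_pair q j * kern q j j * (1 - q ^ j)"
    by (simp add: Suc ring_distribs)
  also have "\<dots> = (- 1) ^ i * q ^ (Suc i choose 2) / qp q q (j + i)
      - (1 + q ^ Suc i) * (1 - q ^ Suc i) * (- 1) ^ i * q ^ (Suc i choose 2) / qp q q (Suc (j + i))"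
    using partial[of i] by (simp add: Suc unit_pair_def kern_def)
  also have "(1 + q ^ Suc i) * (1 - q ^ Suc i) = 1 - q ^ Suc (j + i)"
    unfolding Suc by (simp add: algebra_simps power_add)
  finally have "(\<Sum>k\<le>j. unit_pair q k * kern q j k) * (1 - q ^ j) = 0"
    using nz[of "j + i"] by (simp add: qp_Suc)
  then show ?thesis
    using nz[of i] Suc by simp
qed (simp add: unit_pair_def kern_def)

text \<open>The beta side of the unit pair is concentrated at 0, so Bailey's lemma leaves only the
  coefficient \<open>saal_coeff q d e j 0\<close>, which is (de/q)_j / (q)_j.\<close>

lemma well_poised_bailey_pair:
  assumes q: "\<And>k. qp q q k \<noteq> 0" "q \<noteq> 0"
    and d: "d \<noteq> 0" "\<And>k. qp q d k \<noteq> 0" and e: "e \<noteq> 0" "\<And>k. qp q e k \<noteq> 0"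
  shows "(\<Sum>k\<le>j. unit_pair q k * well_poised q d e k * kern q j k)
    = qp q (d * e / q) j / (qp q q j * qp q d j * qp q e j)"
proof -
  have "qp q d j * qp q e j * (\<Sum>k\<le>j. unit_pair q k * well_poised q d e k * kern q j k)
    = (\<Sum>i\<le>j. saal_coeff q d e j i * (if i = 0 then 1 else 0))"
    using unit_bailey_pair[OF q(1)] by (rule bailey_lemma[OF q d e])
  also have "\<dots> = qp q (d * e / q) j / qp q q j"
    by (simp add: if_distrib sum.delta saal_coeff_def cong: if_cong)
  finally show ?thesis
    using d(2)[of j] e(2)[of j] q(1)[of j] by (simp add: field_simps)
qed

text \<open>Going from i + 1 down to i multiplies the kernel by (1 - q^(i+1-k)) (1 - q^(i+1+k)) = 1
  + q^(2i+2) - q^(i+1) (q^k + q^(-k)). At k = i + 1 the lower kernel ought to be 0, which truncated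
  subtraction does not give; hence the conditional.\<close>

lemma kern_rec:
  assumes q: "\<And>k. qp q q k \<noteq> 0" "q \<noteq> 0" and "k \<le> Suc i"
  shows "(q ^ k + 1 / q ^ k) * kern q (Suc i) k
    = ((1 + q ^ Suc i * q ^ Suc i) * kern q (Suc i) k - (if k \<le> i then kern q i k else 0)) / q ^ Suc i"
proof (cases "k \<le> i")
  case True
  then obtain l where i: "i = k + l" using le_Suc_ex by blast
  have "1 - q ^ Suc m \<noteq> 0" for m
    using q(1)[of "Suc m"] by (simp add: qp_Suc)
  note nz = this[of l] this[of "i + k"]
  have y: "kern q i k = kern q (Suc i) k * (1 - q ^ Suc l) * (1 - q ^ Suc (i + k))"
    using nz by (simp add: kern_def i qp_Suc)
  have x: "(q ^ k + 1 / q ^ k) * q ^ Suc i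
      = (1 + q ^ Suc i * q ^ Suc i) - (1 - q ^ Suc l) * (1 - q ^ Suc (i + k))"
    using q(2) by (simp add: i power_add field_simps)
  have "((q ^ k + 1 / q ^ k) * q ^ Suc i) * kern q (Suc i) k
      = (1 + q ^ Suc i * q ^ Suc i) * kern q (Suc i) k - kern q i k"
    unfolding x y by (simp only: ring_distribs mult_ac) simp
  with True q(2) show ?thesis
    by (simp add: eq_divide_eq mult_ac)
next
  case False
  with assms have "k = Suc i" by simp
  then show ?thesis using q(2) by (simp add: field_simps)
qed

lemma kern_moment:
  assumes q: "\<And>k. qp q q k \<noteq> 0" "q \<noteq> 0"
  shows "(\<Sum>k\<le>Suc i. \<alpha> k * (q ^ k + 1 / q ^ k) * kern q (Suc i) k)
    = ((1 + q ^ Suc i * q ^ Suc i) * (\<Sum>k\<le>Suc i. \<alpha> k * kern q (Suc i) k)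
       - (\<Sum>k\<le>i. \<alpha> k * kern q i k)) / q ^ Suc i"
proof -
  have "(\<Sum>k\<le>Suc i. \<alpha> k * (q ^ k + 1 / q ^ k) * kern q (Suc i) k)
    = (\<Sum>k\<le>Suc i. ((1 + q ^ Suc i * q ^ Suc i) * (\<alpha> k * kern q (Suc i) k)
        - (if k \<le> i then \<alpha> k * kern q i k else 0)) / q ^ Suc i)"
    by (rule sum.cong[OF refl], subst mult.assoc, subst kern_rec[OF q]) (auto simp: algebra_simps)
  also have "\<dots> = ((1 + q ^ Suc i * q ^ Suc i) * (\<Sum>k\<le>Suc i. \<alpha> k * kern q (Suc i) k)
       - (\<Sum>k\<le>Suc i. if k \<le> i then \<alpha> k * kern q i k else 0)) / q ^ Suc i"
    by (simp only: sum_divide_distrib[symmetric] sum_subtractf sum_distrib_left[symmetric])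
  also have "(\<Sum>k\<le>Suc i. if k \<le> i then \<alpha> k * kern q i k else 0) = (\<Sum>k\<le>i. \<alpha> k * kern q i k)"
    by simp
  finally show ?thesis .
qed

text \<open>\<open>P\<close> is the common part of beta_i and beta_(i+1). The remaining polynomials,
  combined as in \<open>kern_moment\<close>, are divisible by q^(i+1), which removes the denominator
  there.\<close>

lemma well_poised_moment:
  fixes q d e :: complex and i :: nat
  defines "u \<equiv> d / q" and "v \<equiv> e / q"
  defines "P \<equiv> qp q (d * e / q) i / (qp q q (Suc i) * qp q d (Suc i) * qp q e (Suc i))"
  assumes q: "\<And>k. qp q q k \<noteq> 0" "q \<noteq> 0"
    and d: "d \<noteq> 0" "\<And>k. qp q d k \<noteq> 0" and e: "e \<noteq> 0" "\<And>k. qp q e k \<noteq> 0"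
  shows "(\<Sum>k\<le>Suc i. unit_pair q k * well_poised q d e k * kern q (Suc i) k) = P * (1 - u * v * q ^ Suc i)"
    and "(\<Sum>k\<le>Suc i. unit_pair q k * well_poised q d e k * (q ^ k + 1 / q ^ k) * kern q (Suc i) k)
      = P * (1 + u + v - u * v + q ^ Suc i * (1 - u - v - u * v))"
proof -
  let ?S = "\<lambda>j. \<Sum>k\<le>j. unit_pair q k * well_poised q d e k * kern q j k"
  have de: "d = u * q" "e = v * q"
    using q(2) by (simp_all add: u_def v_def)
  show S1: "?S (Suc i) = P * (1 - u * v * q ^ Suc i)"
    unfolding well_poised_bailey_pair[OF q d e] P_def qp_Suc[of q "d * e / q"] u_def v_def
    using q(2) by simp
  have "?S i = P * ((1 - q ^ Suc i) * (1 - d * q ^ i) * (1 - e * q ^ i))"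
    unfolding well_poised_bailey_pair[OF q d e] P_def
    using q(1)[of "Suc i"] d(2)[of "Suc i"] e(2)[of "Suc i"] by (simp add: qp_Suc)
  then have S0: "?S i = P * ((1 - q ^ Suc i) * (1 - u * q ^ Suc i) * (1 - v * q ^ Suc i))"
    by (simp add: de mult_ac)
  define Y where "Y = q ^ Suc i"
  have "Y \<noteq> 0" using q(2) by (simp add: Y_def)
  have "(1 + Y * Y) * (P * (1 - u * v * Y)) - P * ((1 - Y) * (1 - u * Y) * (1 - v * Y))
    = P * (1 + u + v - u * v + Y * (1 - u - v - u * v)) * Y"
    by algebra
  with \<open>Y \<noteq> 0\<close> show "(\<Sum>k\<le>Suc i. unit_pair q k * well_poised q d e k * (q ^ k + 1 / q ^ k) * kern q (Suc i) k)
      = P * (1 + u + v - u * v + q ^ Suc i * (1 - u - v - u * v))"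
    unfolding kern_moment[OF q] S0 S1 Y_def[symmetric] by simp
qed

text \<open>The affine factors arise from adding the terms k and -k of the two bilateral series (see
  \<open>weight_identities\<close>). In the first combination the part proportional to q^j cancels,
  in the second the constant part; either way the coefficient (1 - u)(1 - v)(1 - uv) remains, whose
  last factor extends (de/q)_(j-1) to (de/q^2)_j.\<close>

lemma nearly_poised_bailey_pairs:
  fixes q d e :: complex and j :: nat
  defines "u \<equiv> d / q" and "v \<equiv> e / q"
  assumes q: "\<And>k. qp q q k \<noteq> 0" "q \<noteq> 0"
    and d: "d \<noteq> 0" "\<And>k. qp q d k \<noteq> 0" and e: "e \<noteq> 0" "\<And>k. qp q e k \<noteq> 0"
  defines "\<beta> \<equiv> (1 - u) * (1 - v) * qp q (d * e / q\<^sup>2) j / (qp q q j * qp q d j * qp q e j)"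
  shows "(\<Sum>k\<le>j. unit_pair q k * well_poised q d e k * (1 - u - v + u * v * (q ^ k + 1 / q ^ k - 1)) * kern q j k) = \<beta>"
    and "(\<Sum>k\<le>j. unit_pair q k * well_poised q d e k * (q ^ k + 1 / q ^ k - 1 - u - v + u * v) * kern q j k) = \<beta> * q ^ j"
proof -
  define S where "S = (\<Sum>k\<le>j. unit_pair q k * well_poised q d e k * kern q j k)"
  define X where "X = (\<Sum>k\<le>j. unit_pair q k * well_poised q d e k * (q ^ k + 1 / q ^ k) * kern q j k)"
  have 1: "(\<Sum>k\<le>j. unit_pair q k * well_poised q d e k * (1 - u - v + u * v * (q ^ k + 1 / q ^ k - 1)) * kern q j k)
     = (1 - u - v - u * v) * S + u * v * X"
    unfolding S_def X_def sum_distrib_left sum.distrib[symmetric]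
    by (intro sum.cong refl) (simp add: algebra_simps)
  have 2: "(\<Sum>k\<le>j. unit_pair q k * well_poised q d e k * (q ^ k + 1 / q ^ k - 1 - u - v + u * v) * kern q j k)
     = (u * v - 1 - u - v) * S + X"
    unfolding S_def X_def sum_distrib_left sum.distrib[symmetric]
    by (intro sum.cong refl) (simp add: algebra_simps)
  have "(1 - u - v - u * v) * S + u * v * X = \<beta> \<and> (u * v - 1 - u - v) * S + X = \<beta> * q ^ j"
  proof (cases j)
    case 0
    have "S = 1" "X = 2" "\<beta> = (1 - u) * (1 - v)"
      by (simp_all add: S_def X_def \<beta>_def 0 unit_pair_def well_poised_def kern_def)
    then show ?thesis by (simp add: 0 algebra_simps)
  next
    case (Suc i)
    define P where "P = qp q (d * e / q) i / (qp q q j * qp q d j * qp q e j)"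
    have S: "S = P * (1 - u * v * q ^ j)"
      and X: "X = P * (1 + u + v - u * v + q ^ j * (1 - u - v - u * v))"
      using well_poised_moment[OF q d e, of i] by (simp_all add: S_def X_def P_def u_def v_def Suc del: power_Suc sum.atMost_Suc)
    have "qp q (d * e / q\<^sup>2) j = (1 - u * v) * qp q (d * e / q) i"
      using q(2) by (simp add: Suc qp_Suc_left u_def v_def power2_eq_square)
    then have \<beta>: "\<beta> = (1 - u) * (1 - v) * (1 - u * v) * P"
      by (simp add: \<beta>_def P_def)
    show ?thesis
      unfolding S X \<beta> by (intro conjI; algebra)
  qed
  then show "(\<Sum>k\<le>j. unit_pair q k * well_poised q d e k * (1 - u - v + u * v * (q ^ k + 1 / q ^ k - 1)) * kern q j k) = \<beta>"
    and "(\<Sum>k\<le>j. unit_pair q k * well_poised q d e k * (q ^ k + 1 / q ^ k - 1 - u - v + u * v) * kern q j k) = \<beta> * q ^ j"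
    unfolding 1 2 by blast+
qed

section \<open>Infinite products and bilateral sums with finite support\<close>

lemma qpoch_inf_split:
  assumes "cmod q < 1"
  shows "qpoch_inf q a = qp q a n * qpoch_inf q (a * q ^ n)"
proof -
  \<comment> \<open>Summability of |b q^j| makes the product converge, even if a factor
    vanishes.\<close>
  have lim: "qp q b \<longlonglongrightarrow> qpoch_inf q b" for b
  proof -
    have "summable (\<lambda>j. cmod (1 - b * q ^ j - 1))"
      using assms by (simp add: norm_mult norm_power summable_geometric summable_mult)
    then have "convergent_prod (\<lambda>j. 1 - b * q ^ j)"
      by (intro abs_convergent_prod_imp_convergent_prod summable_imp_abs_convergent_prod)
    from convergent_prod_LIMSEQ[OF this] have "(\<lambda>n. qp q b (Suc n)) \<longlonglongrightarrow> qpoch_inf q b"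
      by (simp add: qp_def qpoch_inf_def lessThan_Suc_atMost del: prod.lessThan_Suc)
    then show ?thesis by (rule LIMSEQ_imp_Suc)
  qed
  have "(\<lambda>m. qp q a (m + n)) \<longlonglongrightarrow> qpoch_inf q a"
    by (rule LIMSEQ_ignore_initial_segment[OF lim])
  moreover have "(\<lambda>m. qp q a (m + n)) \<longlonglongrightarrow> qp q a n * qpoch_inf q (a * q ^ n)"
    unfolding add.commute[of _ n] qp_add by (intro tendsto_intros lim)
  ultimately show ?thesis by (rule LIMSEQ_unique)
qed

lemma infsum_int_symmetric:
  fixes f :: "int \<Rightarrow> complex"
  assumes "\<And>k. n < k \<Longrightarrow> f (int k) = 0" "\<And>k. n < k \<Longrightarrow> f (- int k) = 0"
  shows "infsum f UNIV = (\<Sum>k\<le>n. if k = 0 then f 0 else f (int k) + f (- int k))"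
proof -
  have "f k = 0" if "k \<notin> {- int n..int n}" for k
  proof (cases "k \<ge> 0")
    case True
    with that show ?thesis using assms(1)[of "nat k"] by auto
  next
    case False
    with that show ?thesis using assms(2)[of "nat (- k)"] by auto
  qed
  then have "infsum f UNIV = infsum f {- int n..int n}"
    by (intro infsum_cong_neutral) auto
  also have "\<dots> = sum f {- int n..int n}"
    by simp
  also have "\<dots> = (\<Sum>k\<le>n. if k = 0 then f 0 else f (int k) + f (- int k))"
  proof (induction n)
    case (Suc n)
    have "{- int (Suc n)..int (Suc n)} = insert (int (Suc n)) (insert (- int (Suc n)) {- int n..int n})"
      by auto
    with Suc show ?case by simp
  qed simp
  finally show ?thesis .
qed

section \<open>The quotients (q/x)_k / (x)_k and their reflection k to -k\<close>

definition refl_ratio :: "complex \<Rightarrow> complex \<Rightarrow> nat \<Rightarrow> complex" where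
  "refl_ratio q x k = qp q (q / x) k / qp q x k"

lemma refl_ratio_nat: "qpoch q (q / x) (int k) / qpoch q x (int k) = refl_ratio q x k"
  by (simp add: refl_ratio_def qpoch_nat)

lemma refl_ratio_neg:
  assumes "q \<noteq> 0" "x \<noteq> 0"
  shows "qpoch q (q / x) (- int k) / qpoch q x (- int k) = (x\<^sup>2 / q) ^ k * refl_ratio q x k"
  using qp_neg_ratio[OF assms, of k] by (simp add: refl_ratio_def qpoch_neg divide_inverse mult.commute)

text \<open>Splitting (x/q)_(k+1) at either end gives (x/q)_k (1 - x q^(k-1)) = (1 - x/q) (x)_k. The
  right side is nonzero, so one may divide by the end factor on the left.\<close>

lemma refl_ratio_shift_nat:
  assumes "q \<noteq> 0" "x / q \<noteq> 1" "qp q x k \<noteq> 0"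
  shows "qpoch q (q / x) (int k) / qpoch q (x / q) (int k)
    = refl_ratio q x k * ((1 - x / q * q ^ k) / (1 - x / q))"
proof -
  have *: "qp q (x / q) k * (1 - x / q * q ^ k) = (1 - x / q) * qp q x k"
    using qp_Suc_left[of q "x / q" k] assms(1) by (simp add: qp_Suc)
  define N w where "N = 1 - x / q" and "w = 1 - x / q * q ^ k"
  have "N \<noteq> 0" using assms by (simp add: N_def)
  with * assms have "w \<noteq> 0" by (auto simp: N_def w_def)
  with * have "qp q (x / q) k = N * qp q x k / w"
    by (metis N_def w_def nonzero_eq_divide_eq)
  then show ?thesis
    unfolding N_def[symmetric] w_def[symmetric] by (simp add: refl_ratio_def qpoch_nat mult_ac)
qed

lemma refl_ratio_shift_neg:
  assumes "q \<noteq> 0" "x \<noteq> 0" "x / q \<noteq> 1"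
  shows "qpoch q (q / x) (- int k) / qpoch q (x / q) (- int k)
    = (x\<^sup>2 / q) ^ k * refl_ratio q x k * ((1 - x / q / q ^ k) / (1 - x / q))"
proof -
  have "(\<Prod>i<k. 1 - x / q / q ^ Suc i) * (1 - x / q) = (\<Prod>i<k. 1 - x / q ^ Suc i) * (1 - x / q / q ^ k)"
    by (induction k) (simp_all add: mult_ac)
  then have "(\<Prod>i<k. 1 - x / q / q ^ Suc i)
      = (\<Prod>i<k. 1 - x / q ^ Suc i) * ((1 - x / q / q ^ k) / (1 - x / q))"
    using assms(3) by (metis nonzero_eq_divide_eq right_minus_eq times_divide_eq_right)
  then have "qpoch q (q / x) (- int k) / qpoch q (x / q) (- int k)
    = (qpoch q (q / x) (- int k) / qpoch q x (- int k)) * ((1 - x / q / q ^ k) / (1 - x / q))"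
    unfolding qpoch_neg by (simp add: divide_inverse mult_ac)
  then show ?thesis
    by (simp only: refl_ratio_neg[OF assms(1,2)])
qed

text \<open>For x = q^(n+1), reversing (q/x)_k = (q^(-n))_k and using (q)_(n+k) = (q)_n (q^(n+1))_k
  yields the kernel, together with the sign and the power q^(k choose 2) of the unit pair.\<close>

lemma refl_ratio_head:
  assumes q: "\<And>k. qp q q k \<noteq> 0" "q \<noteq> 0" and "k \<le> n"
  shows "refl_ratio q (q ^ Suc n) k * (q ^ Suc n) ^ k
    = (- 1) ^ k * q ^ (k choose 2) * q ^ k * ((qp q q n)\<^sup>2 * kern q n k)"
proof -
  define Q where "Q = q ^ Suc n"
  define X where "X = qp q (q / Q) k"
  have "qp q q n * q ^ (k choose 2) * q ^ k = qp q q (n - k) * (- Q) ^ k * X"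
    using qp_reverse[OF q(2) q(2) \<open>k \<le> n\<close>] by (simp add: Q_def X_def)
  then have "X * Q ^ k * qp q q (n - k) = (- 1) ^ k * q ^ (k choose 2) * q ^ k * qp q q n"
    by (cases "even k") (simp_all add: mult_ac)
  then have X: "X * Q ^ k = (- 1) ^ k * q ^ (k choose 2) * q ^ k * qp q q n / qp q q (n - k)"
    using q(1)[of "n - k"] by (metis nonzero_eq_divide_eq)
  have "qp q q (n + k) = qp q q n * qp q Q k"
    by (simp add: qp_add Q_def)
  then have Y: "qp q Q k = qp q q (n + k) / qp q q n"
    using q(1)[of n] by simp
  have "refl_ratio q Q k * Q ^ k = X * Q ^ k / qp q Q k"
    by (simp add: refl_ratio_def X_def)
  also have "\<dots> = (- 1) ^ k * q ^ (k choose 2) * q ^ k * ((qp q q n)\<^sup>2 * kern q n k)"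
    unfolding X Y by (simp add: kern_def power2_eq_square)
  finally show ?thesis
    by (simp only: Q_def)
qed

lemma well_poised_eq_refl_ratio:
  assumes "q \<noteq> 0"
  shows "well_poised q b c k * q ^ k = (b * c) ^ k * refl_ratio q b k * refl_ratio q c k"
  using assms by (simp add: well_poised_def refl_ratio_def power_divide)

text \<open>Since q^3/(abc) = q/(x q^n) for a = q^(n+1), both factorials are reversals, of (q)_n and
  of (x)_n, and the signs and quadratic powers of q cancel. This matches the right-hand series with
  \<open>saal_coeff\<close>.\<close>

lemma head_ratio:
  fixes q b c :: complex and n k :: nat
  defines "x \<equiv> b * c / q"
  assumes q: "\<And>k. qp q q k \<noteq> 0" "q \<noteq> 0" and bc: "b \<noteq> 0" "c \<noteq> 0"
    and x: "qp q x n \<noteq> 0" and "k \<le> n"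
  shows "qp q (q / q ^ Suc n) k / qp q (q ^ 3 / (q ^ Suc n * b * c)) k * q ^ k
    = x ^ k * qp q x (n - k) / qp q q (n - k) * (qp q q n / qp q x n)"
proof -
  have x0: "x \<noteq> 0" using q(2) bc by (simp add: x_def)
  define T where "T = q ^ (k choose 2) * q ^ k"
  have T: "T \<noteq> 0" using q(2) by (simp add: T_def)
  have e: "q ^ 3 / (q ^ Suc n * b * c) = q / (x * q ^ n)"
    using q(2) bc by (simp add: x_def power3_eq_cube)
  have X: "qp q q n * T = qp q q (n - k) * (- (q ^ Suc n)) ^ k * qp q (q / q ^ Suc n) k"
    using qp_reverse[OF q(2) q(2) \<open>k \<le> n\<close>] by (simp add: T_def mult_ac)
  have Y: "qp q x n * T = qp q x (n - k) * (- (x * q ^ n)) ^ k * qp q (q / (x * q ^ n)) k"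
    using qp_reverse[OF q(2) x0 \<open>k \<le> n\<close>] by (simp add: T_def mult_ac)
  have "qp q x n * T \<noteq> 0" using x T by simp
  with Y have nz: "qp q x (n - k) \<noteq> 0" "qp q (q / (x * q ^ n)) k \<noteq> 0" by auto
  have X': "qp q (q / q ^ Suc n) k = qp q q n * T / (qp q q (n - k) * (- (q ^ Suc n)) ^ k)"
    using X q by (simp add: eq_divide_eq mult_ac)
  have Y': "qp q (q / (x * q ^ n)) k = qp q x n * T / (qp q x (n - k) * (- (x * q ^ n)) ^ k)"
    using Y nz q(2) x0 by (simp add: eq_divide_eq mult_ac)
  have p: "(- (x * q ^ n)) ^ k * q ^ k = x ^ k * (- (q ^ Suc n)) ^ k"
    by (simp flip: power_mult_distrib add: mult_ac)
  have "qp q (q / q ^ Suc n) k / qp q (q / (x * q ^ n)) k * q ^ k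
      = qp q x (n - k) / qp q q (n - k) * (qp q q n / qp q x n)
        * (((- (x * q ^ n)) ^ k * q ^ k) / (- (q ^ Suc n)) ^ k)"
    unfolding X' Y' using T by simp (simp only: mult_ac)
  also have "\<dots> = x ^ k * qp q x (n - k) / qp q q (n - k) * (qp q q n / qp q x n)"
    unfolding p using q(2) by simp
  finally show ?thesis unfolding e .
qed

section \<open>The bilateral sum for a = q^(n+1)\<close>

definition bilateral_term :: "complex \<Rightarrow> complex \<Rightarrow> complex \<Rightarrow> complex \<Rightarrow> complex \<Rightarrow> complex \<Rightarrow> complex \<Rightarrow> int \<Rightarrow> complex" where
  "bilateral_term q a b c d e z k = (qpoch q (q / a) k * qpoch q (q / b) k * qpoch q (q / c) k
          * qpoch q (q / d) k * qpoch q (q / e) k)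
        / (qpoch q a k * qpoch q b k * qpoch q c k * qpoch q (d / q) k * qpoch q (e / q) k)
        * z powi k"

text \<open>Reflection contributes (x^2/q)^k for each of the five parameters x, in total
  (P^2/q^5)^k. Against (r/P)^k this leaves P^k (r/q^5)^k, so both terms share the factor P^k and the
  five ratios.\<close>

lemma bilateral_term_pair:
  fixes q a b c d e r :: complex and k :: nat
  defines "u \<equiv> d / q" and "v \<equiv> e / q" and "P \<equiv> a * b * c * d * e"
  assumes q: "q \<noteq> 0" and nz: "a \<noteq> 0" "b \<noteq> 0" "c \<noteq> 0" "d \<noteq> 0" "e \<noteq> 0" "r \<noteq> 0"
    and uv: "u \<noteq> 1" "v \<noteq> 1" and de: "qp q d k \<noteq> 0" "qp q e k \<noteq> 0"
  shows "bilateral_term q a b c d e (P / r) (int k) + bilateral_term q a b c d e (P / r) (- int k)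
    = (refl_ratio q a k * a ^ k) * ((b * c) ^ k * refl_ratio q b k * refl_ratio q c k) * ((d * e) ^ k * refl_ratio q d k * refl_ratio q e k)
      / ((1 - u) * (1 - v))
      * ((1 - u * q ^ k) * (1 - v * q ^ k) / r ^ k + (r / q ^ 5) ^ k * ((1 - u / q ^ k) * (1 - v / q ^ k)))"
proof -
  define V where "V = refl_ratio q a k * refl_ratio q b k * refl_ratio q c k * refl_ratio q d k * refl_ratio q e k"
  define M N where "M = (1 - u * q ^ k) / (1 - u) * ((1 - v * q ^ k) / (1 - v))"
    and "N = (1 - u / q ^ k) / (1 - u) * ((1 - v / q ^ k) / (1 - v))"
  have P: "P \<noteq> 0" using nz by (simp add: P_def)
  have split: "bilateral_term q a b c d e z i = (qpoch q (q / a) i / qpoch q a i) * (qpoch q (q / b) i / qpoch q b i)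
      * (qpoch q (q / c) i / qpoch q c i) * (qpoch q (q / d) i / qpoch q (d / q) i)
      * (qpoch q (q / e) i / qpoch q (e / q) i) * z powi i" for z i
    by (simp add: bilateral_term_def)
  have "bilateral_term q a b c d e (P / r) (int k) = V * M * (P / r) ^ k"
    unfolding split refl_ratio_nat refl_ratio_shift_nat[OF q uv(1)[unfolded u_def] de(1)]
      refl_ratio_shift_nat[OF q uv(2)[unfolded v_def] de(2)] V_def M_def u_def v_def
    by (simp only: power_int_of_nat mult_ac)
  also have "\<dots> = V * M * P ^ k / r ^ k"
    by (simp add: power_divide)
  finally have pos: "bilateral_term q a b c d e (P / r) (int k) = V * M * P ^ k / r ^ k" .
  have "bilateral_term q a b c d e (P / r) (- int k) = V * N
      * ((a\<^sup>2 / q) ^ k * (b\<^sup>2 / q) ^ k * (c\<^sup>2 / q) ^ k * (d\<^sup>2 / q) ^ k * (e\<^sup>2 / q) ^ k * (r / P) ^ k)"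
    using uv nz unfolding split u_def v_def
    by (simp only: refl_ratio_neg[OF q] refl_ratio_shift_neg[OF q] V_def N_def u_def v_def not_False_eq_True
      power_int_minus power_int_of_nat power_inverse[symmetric] inverse_divide mult_ac)
  also have "(a\<^sup>2 / q) ^ k * (b\<^sup>2 / q) ^ k * (c\<^sup>2 / q) ^ k * (d\<^sup>2 / q) ^ k * (e\<^sup>2 / q) ^ k * (r / P) ^ k
      = (P * (r / q ^ 5)) ^ k"
    unfolding power_mult_distrib[symmetric] using nz(1-5)
    by (intro arg_cong[of _ _ "\<lambda>x. x ^ k"]) (simp add: P_def eval_nat_numeral)
  finally have neg: "bilateral_term q a b c d e (P / r) (- int k) = V * N * (P ^ k * (r / q ^ 5) ^ k)"
    by (simp only: power_mult_distrib)
  have Pk: "P ^ k = a ^ k * (b * c) ^ k * (d * e) ^ k"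
    by (simp add: P_def power_mult_distrib)
  define U W W' where "U = (1 - u) * (1 - v)" and "W = (1 - u * q ^ k) * (1 - v * q ^ k)"
    and "W' = (1 - u / q ^ k) * (1 - v / q ^ k)"
  have MN: "M = W / U" "N = W' / U"
    by (simp_all add: M_def N_def U_def W_def W'_def)
  show ?thesis
    unfolding pos neg V_def Pk MN U_def[symmetric] W_def[symmetric] W'_def[symmetric]
    by (simp only: distrib_left divide_inverse mult_ac)
qed

text \<open>Both products contain the factor 1 - 1. The second value is a default at a pole, but it
  is used in a denominator, where division by 0 gives 0, the true value of 1/(q^(n+1))_(-k).\<close>

lemma qpoch_head_eq_0:
  assumes "q \<noteq> 0" "n < k"
  shows "qp q (q / q ^ Suc n) k = 0" "qpoch q (q ^ Suc n) (- int k) = 0"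
  using assms by (auto simp: qp_def qpoch_neg)

text \<open>One proof serves both identities: \<open>r\<close> fixes the argument of the series,
  \<open>L\<close> is the factor left by adding the terms k and -k, and \<open>w\<close> is the
  weight that it puts on beta_j.\<close>

lemma bilateral_transformation:
  fixes q b c d e r :: complex and n :: nat and L w :: "nat \<Rightarrow> complex"
  defines "u \<equiv> d / q" and "v \<equiv> e / q" and "a \<equiv> q ^ Suc n"
  assumes q: "\<And>k. qp q q k \<noteq> 0" "q \<noteq> 0"
    and b: "b \<noteq> 0" "\<And>k. qp q b k \<noteq> 0" and c: "c \<noteq> 0" "\<And>k. qp q c k \<noteq> 0"
    and d: "d \<noteq> 0" "\<And>k. qp q d k \<noteq> 0" and e: "e \<noteq> 0" "\<And>k. qp q e k \<noteq> 0"
    and uv: "u \<noteq> 1" "v \<noteq> 1" and r: "r \<noteq> 0" and bc: "qp q (b * c / q) n \<noteq> 0"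
    and L: "\<And>k. (1 - u * q ^ k) * (1 - v * q ^ k) / r ^ k + (r / q ^ 5) ^ k * ((1 - u / q ^ k) * (1 - v / q ^ k))
      = (1 + q ^ k) * L k / (q ^ k) ^ 3"
    and pair: "\<And>j. (\<Sum>k\<le>j. unit_pair q k * well_poised q d e k * L k * kern q j k)
      = (1 - u) * (1 - v) * qp q (d * e / q\<^sup>2) j / (qp q q j * qp q d j * qp q e j) * w j"
  shows "infsum (bilateral_term q a b c d e (a * b * c * d * e / r)) UNIV
    = qp q q n * qp q (b * c / q) n / (qp q b n * qp q c n)
      * (\<Sum>k. (qp q (q / a) k * qp q (q / b) k * qp q (q / c) k * qp q (d * e / q\<^sup>2) k)
         / (qp q q k * qp q (q ^ 3 / (a * b * c)) k * qp q d k * qp q e k) * (q ^ k * w k))"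
proof -
  define f where "f = bilateral_term q a b c d e (a * b * c * d * e / r)"
  define N where "N = (1 - u) * (1 - v)"
  define x where "x = b * c / q"
  define R where "R k = (qp q (q / a) k * qp q (q / b) k * qp q (q / c) k * qp q (d * e / q\<^sup>2) k)
         / (qp q q k * qp q (q ^ 3 / (a * b * c)) k * qp q d k * qp q e k) * (q ^ k * w k)" for k
  have a: "a \<noteq> 0" using q by (simp add: a_def)
  have N: "N \<noteq> 0" using uv by (simp add: N_def)
  \<comment> \<open>At k = 0 the hypothesis reads 2 (1 - u)(1 - v) = 2 L(0), so the unpaired central
    term follows the pattern of the others.\<close>
  have L0: "L 0 = N" using L[of 0] by (simp add: N_def)
  have f_pair: "(if k = 0 then f 0 else f (int k) + f (- int k))
      = (qp q q n)\<^sup>2 / N * (unit_pair q k * well_poised q d e k * L k * well_poised q b c k * kern q n k)" if "k \<le> n" for k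
  proof (cases "k = 0")
    case True
    then show ?thesis
      using q(1)[of n] N L0 by (simp add: f_def bilateral_term_def qpoch_def unit_pair_def well_poised_def kern_def power2_eq_square)
  next
    case False
    have "f (int k) + f (- int k) = (refl_ratio q a k * a ^ k) * (well_poised q b c k * q ^ k) * (well_poised q d e k * q ^ k) / N
       * ((1 + q ^ k) * L k / (q ^ k) ^ 3)"
      unfolding f_def N_def well_poised_eq_refl_ratio[OF q(2)] L[symmetric] u_def v_def
      by (rule bilateral_term_pair) (use q a b c d e r uv in \<open>auto simp: u_def v_def\<close>)
    also have "refl_ratio q a k * a ^ k = (- 1) ^ k * q ^ (k choose 2) * q ^ k * ((qp q q n)\<^sup>2 * kern q n k)"
      unfolding a_def by (rule refl_ratio_head[OF q that])
    finally show ?thesis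
      using False q(2) by (simp add: unit_pair_def power3_eq_cube)
  qed
  have "infsum f UNIV = (\<Sum>k\<le>n. if k = 0 then f 0 else f (int k) + f (- int k))"
    by (rule infsum_int_symmetric)
      (simp_all add: f_def bilateral_term_def a_def qpoch_nat qpoch_head_eq_0[OF q(2)] del: power_Suc)
  also have "\<dots> = (qp q q n)\<^sup>2 / N * (\<Sum>k\<le>n. unit_pair q k * well_poised q d e k * L k * well_poised q b c k * kern q n k)"
    by (simp add: f_pair sum_distrib_left)
  also have "(\<Sum>k\<le>n. unit_pair q k * well_poised q d e k * L k * well_poised q b c k * kern q n k)
     = (\<Sum>j\<le>n. saal_coeff q b c n j
         * (N * qp q (d * e / q\<^sup>2) j / (qp q q j * qp q d j * qp q e j) * w j)) / (qp q b n * qp q c n)"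
    using bailey_lemma[OF q b c pair, of n] b(2)[of n] c(2)[of n]
    by (simp add: eq_divide_eq N_def mult_ac)
  also have "(\<Sum>j\<le>n. saal_coeff q b c n j
         * (N * qp q (d * e / q\<^sup>2) j / (qp q q j * qp q d j * qp q e j) * w j))
     = N * (\<Sum>j\<le>n. saal_coeff q b c n j
         * (qp q (d * e / q\<^sup>2) j / (qp q q j * qp q d j * qp q e j) * w j))"
    unfolding sum_distrib_left by (intro sum.cong refl) (simp add: mult_ac)
  finally have "infsum f UNIV = qp q q n * qp q x n / (qp q b n * qp q c n)
      * (qp q q n / qp q x n
         * (\<Sum>j\<le>n. saal_coeff q b c n j * (qp q (d * e / q\<^sup>2) j / (qp q q j * qp q d j * qp q e j) * w j)))"
    using N bc unfolding x_def[symmetric] by (simp add: power2_eq_square)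
  also have "qp q q n / qp q x n
         * (\<Sum>j\<le>n. saal_coeff q b c n j * (qp q (d * e / q\<^sup>2) j / (qp q q j * qp q d j * qp q e j) * w j))
    = (\<Sum>j\<le>n. R j)"
    unfolding sum_distrib_left
  proof (rule sum.cong[OF refl])
    fix j assume "j \<in> {..n}"
    then have "j \<le> n" by simp
    have "R j = (qp q (q / a) j / qp q (q ^ 3 / (a * b * c)) j * q ^ j)
        * (qp q (q / b) j * qp q (q / c) j) * (qp q (d * e / q\<^sup>2) j / (qp q q j * qp q d j * qp q e j) * w j)"
      by (simp add: R_def mult_ac)
    also have "qp q (q / a) j / qp q (q ^ 3 / (a * b * c)) j * q ^ j
       = x ^ j * qp q x (n - j) / qp q q (n - j) * (qp q q n / qp q x n)"
      unfolding a_def x_def by (rule head_ratio[OF q b(1) c(1) bc \<open>j \<le> n\<close>])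
    finally show "qp q q n / qp q x n * (saal_coeff q b c n j
        * (qp q (d * e / q\<^sup>2) j / (qp q q j * qp q d j * qp q e j) * w j)) = R j"
      by (simp add: saal_coeff_def x_def mult_ac)
  qed
  \<comment> \<open>The series stops at n because (q^(-n))_j = 0 for j > n.\<close>
  also have "(\<Sum>j\<le>n. R j) = (\<Sum>j. R j)"
    by (rule suminf_finite[symmetric])
      (simp_all add: R_def a_def qpoch_head_eq_0[OF q(2)] del: power_Suc)
  finally show ?thesis
    by (simp only: f_def x_def R_def)
qed

section \<open>Infinite prefactors and symmetry in a, b, c\<close>

definition transformation :: "complex \<Rightarrow> complex \<Rightarrow> complex \<Rightarrow> complex \<Rightarrow> complex \<Rightarrow> complex
    \<Rightarrow> complex \<Rightarrow> (nat \<Rightarrow> complex) \<Rightarrow> bool" where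
  "transformation q a b c d e r w \<longleftrightarrow>
    infsum (bilateral_term q a b c d e (a * b * c * d * e / r)) UNIV
    = (qpoch_inf q q * qpoch_inf q (a * b / q) * qpoch_inf q (b * c / q) * qpoch_inf q (a * c / q))
        / (qpoch_inf q a * qpoch_inf q b * qpoch_inf q c * qpoch_inf q (a * b * c / q ^ 2))
      * (\<Sum>k. (qp q (q / a) k * qp q (q / b) k * qp q (q / c) k * qp q (d * e / q\<^sup>2) k)
         / (qp q q k * qp q (q ^ 3 / (a * b * c)) k * qp q d k * qp q e k) * w k)"

text \<open>Both sides are symmetric in a, b, c, so whichever of them is a power of q can take the
  place of a.\<close>

lemma transformation_swap:
  "transformation q a b c d e r w \<longleftrightarrow> transformation q b a c d e r w"
  "transformation q a b c d e r w \<longleftrightarrow> transformation q c b a d e r w"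
proof -
  have "bilateral_term q a b c d e z = bilateral_term q b a c d e z" "bilateral_term q a b c d e z = bilateral_term q c b a d e z" for z
    unfolding bilateral_term_def[abs_def] by (simp_all only: mult_ac)
  then show "transformation q a b c d e r w \<longleftrightarrow> transformation q b a c d e r w"
    "transformation q a b c d e r w \<longleftrightarrow> transformation q c b a d e r w"
    unfolding transformation_def by (simp_all only: mult_ac)
qed

text \<open>For a = q^(n+1) the arguments ab/q, ac/q, abc/q^2 are b, c, bc/q times q^n. Splitting n
  factors off the products at q, b, c, bc/q makes all infinite tails cancel.\<close>

lemma prefactor_eq:
  fixes q b c :: complex and n :: nat
  defines "a \<equiv> q ^ Suc n"
  assumes "q \<noteq> 0" "cmod q < 1"
    and nz: "qpoch_inf q a * qpoch_inf q b * qpoch_inf q c * qpoch_inf q (a * b * c / q\<^sup>2) \<noteq> 0"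
  shows "(qpoch_inf q q * qpoch_inf q (a * b / q) * qpoch_inf q (b * c / q) * qpoch_inf q (a * c / q))
        / (qpoch_inf q a * qpoch_inf q b * qpoch_inf q c * qpoch_inf q (a * b * c / q\<^sup>2))
    = qp q q n * qp q (b * c / q) n / (qp q b n * qp q c n)"
proof -
  have e: "a * b / q = b * q ^ n" "a * c / q = c * q ^ n" "a * b * c / q\<^sup>2 = b * c / q * q ^ n"
    using assms(2) by (simp_all add: a_def power2_eq_square)
  have s: "qpoch_inf q q = qp q q n * qpoch_inf q a"
    "qpoch_inf q b = qp q b n * qpoch_inf q (b * q ^ n)"
    "qpoch_inf q c = qp q c n * qpoch_inf q (c * q ^ n)"
    "qpoch_inf q (b * c / q) = qp q (b * c / q) n * qpoch_inf q (b * c / q * q ^ n)"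
    using qpoch_inf_split[OF assms(3), of q n]
    by (simp_all only: a_def power_Suc qpoch_inf_split[OF assms(3), symmetric])
  define A B C D where "A = qpoch_inf q a" and "B = qpoch_inf q (b * q ^ n)"
    and "C = qpoch_inf q (c * q ^ n)" and "D = qpoch_inf q (b * c / q * q ^ n)"
  have "A \<noteq> 0" "B \<noteq> 0" "C \<noteq> 0" "D \<noteq> 0"
    using nz unfolding e s A_def B_def C_def D_def by auto
  then show ?thesis
    unfolding e s A_def[symmetric] B_def[symmetric] C_def[symmetric] D_def[symmetric]
    by (simp add: divide_simps)
qed

text \<open>With Q = q^k these are the combined weights of k and -k for r = q^3 and r = q^4. The
  factor 1 + Q is the one in \<open>unit_pair\<close>; the cofactor is affine in Q + 1/Q.\<close>

lemma weight_identities: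
  fixes Q u v :: complex
  assumes "Q \<noteq> 0"
  shows "(1 - u * Q) * (1 - v * Q) / Q ^ 3 + 1 / Q ^ 2 * ((1 - u / Q) * (1 - v / Q))
      = (1 + Q) * (1 - u - v + u * v * (Q + 1 / Q - 1)) / Q ^ 3"
    and "(1 - u * Q) * (1 - v * Q) / Q ^ 4 + 1 / Q * ((1 - u / Q) * (1 - v / Q))
      = (1 + Q) * (Q + 1 / Q - 1 - u - v + u * v) / Q ^ 3"
  using assms by (simp_all add: field_simps eval_nat_numeral)

lemma transformation_head:
  fixes q b c d e :: complex and n :: nat
  defines "a \<equiv> q ^ Suc n"
  assumes q: "\<And>k. qp q q k \<noteq> 0" "q \<noteq> 0" "cmod q < 1"
    and b: "b \<noteq> 0" "\<And>k. qp q b k \<noteq> 0" and c: "c \<noteq> 0" "\<And>k. qp q c k \<noteq> 0"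
    and d: "d \<noteq> 0" "\<And>k. qp q d k \<noteq> 0" and e: "e \<noteq> 0" "\<And>k. qp q e k \<noteq> 0"
    and uv: "d / q \<noteq> 1" "e / q \<noteq> 1" and abc: "\<And>k. qp q (q ^ 3 / (a * b * c)) k \<noteq> 0"
    and nz: "qpoch_inf q a * qpoch_inf q b * qpoch_inf q c * qpoch_inf q (a * b * c / q\<^sup>2) \<noteq> 0"
  shows "transformation q a b c d e (q ^ 3) (\<lambda>k. q ^ k)
    \<and> transformation q a b c d e (q ^ 4) (\<lambda>k. q ^ (2 * k))"
proof -
  \<comment> \<open>Reversing all n factors turns (bc/q)_n into (q^3/(abc))_n up to a nonzero
    factor.\<close>
  have bc: "qp q (b * c / q) n \<noteq> 0"
  proof -
    have x: "b * c / q \<noteq> 0" using q b c by simp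
    have "q ^ 3 / (a * b * c) = q / (b * c / q * q ^ n)"
      using q b c by (simp add: a_def power3_eq_cube)
    with abc[of n] qp_reverse[OF q(2) x order.refl, of n] x q(2) show ?thesis
      by auto
  qed
  note bt = bilateral_transformation[OF q(1,2) b c d e uv _ bc, folded a_def]
  have Q: "q ^ k \<noteq> 0" for k using q(2) by simp
  have p: "(q ^ 3) ^ k = (q ^ k) ^ 3" "(q ^ 4) ^ k = (q ^ k) ^ 4"
    "(q ^ 3 / q ^ 5) ^ k = 1 / (q ^ k) ^ 2" "(q ^ 4 / q ^ 5) ^ k = 1 / q ^ k" for k
  proof -
    have "q ^ 3 / q ^ 5 = 1 / q ^ 2" "q ^ 4 / q ^ 5 = 1 / q"
      using q(2) by (simp_all add: eval_nat_numeral)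
    then show "(q ^ 3 / q ^ 5) ^ k = 1 / (q ^ k) ^ 2" "(q ^ 4 / q ^ 5) ^ k = 1 / q ^ k"
      by (simp_all add: power_divide mult.commute flip: power_mult)
  qed (simp_all add: mult.commute flip: power_mult)
  \<comment> \<open>The factor 1 is the weight \<open>w\<close>. The Bailey pair goal is shown first
    because it fixes the still open \<open>L\<close>.\<close>
  have "transformation q a b c d e (q ^ 3) (\<lambda>k. q ^ k * 1)"
    unfolding transformation_def prefactor_eq[OF q(2,3) nz[unfolded a_def], folded a_def]
  proof (rule bt)
    show "(\<Sum>k\<le>j. unit_pair q k * well_poised q d e k * (1 - d / q - e / q + d / q * (e / q) * (q ^ k + 1 / q ^ k - 1)) * kern q j k)
      = (1 - d / q) * (1 - e / q) * qp q (d * e / q\<^sup>2) j / (qp q q j * qp q d j * qp q e j) * 1" for j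
      using nearly_poised_bailey_pairs(1)[OF q(1,2) d e] by simp
  qed (use q(2) weight_identities(1)[OF Q] in \<open>simp_all only: p power_not_zero not_False_eq_True\<close>)
  moreover have "transformation q a b c d e (q ^ 4) (\<lambda>k. q ^ k * q ^ k)"
    unfolding transformation_def prefactor_eq[OF q(2,3) nz[unfolded a_def], folded a_def]
  proof (rule bt)
    show "(\<Sum>k\<le>j. unit_pair q k * well_poised q d e k * (q ^ k + 1 / q ^ k - 1 - d / q - e / q + d / q * (e / q)) * kern q j k)
      = (1 - d / q) * (1 - e / q) * qp q (d * e / q\<^sup>2) j / (qp q q j * qp q d j * qp q e j) * q ^ j" for j
      using nearly_poised_bailey_pairs(2)[OF q(1,2) d e] by simp
  qed (use q(2) weight_identities(2)[OF Q] in \<open>simp_all only: p power_not_zero not_False_eq_True\<close>)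
  ultimately show ?thesis
    by (simp add: mult_2 power_add)
qed

theorem theorem1p3:
  fixes q a b c d e :: complex
  assumes hq: "0 < cmod q" "cmod q < 1"
    and hnz: "a \<noteq> 0" "b \<noteq> 0" "c \<noteq> 0" "d \<noteq> 0" "e \<noteq> 0"
    and hpow: "\<exists>n::nat. n \<ge> 1 \<and> (a = q ^ n \<or> b = q ^ n \<or> c = q ^ n)"
    and wd_pos: "\<And>k::int. k \<ge> 0 \<Longrightarrow>
       qpoch q a k * qpoch q b k * qpoch q c k * qpoch q (d / q) k * qpoch q (e / q) k \<noteq> 0"
    and wd_neg: "\<And>k::int. k < 0 \<Longrightarrow>
       qpoch q (q / a) k * qpoch q (q / b) k * qpoch q (q / c) k * qpoch q (q / d) k
         * qpoch q (q / e) k \<noteq> 0"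
    and wd_inf: "qpoch_inf q a * qpoch_inf q b * qpoch_inf q c
                   * qpoch_inf q (a * b * c / q ^ 2) \<noteq> 0"
    and wd_rhs: "\<And>k::nat. qpoch q q (int k) * qpoch q (q ^ 3 / (a * b * c)) (int k)
                   * qpoch q d (int k) * qpoch q e (int k) \<noteq> 0"
  shows
   "(\<Sum>\<^sub>\<infinity>k::int. (qpoch q (q / a) k * qpoch q (q / b) k * qpoch q (q / c) k
          * qpoch q (q / d) k * qpoch q (q / e) k)
        / (qpoch q a k * qpoch q b k * qpoch q c k * qpoch q (d / q) k * qpoch q (e / q) k)
        * (a * b * c * d * e / q ^ 3) powi k)
    = (qpoch_inf q q * qpoch_inf q (a * b / q) * qpoch_inf q (b * c / q) * qpoch_inf q (a * c / q))
        / (qpoch_inf q a * qpoch_inf q b * qpoch_inf q c * qpoch_inf q (a * b * c / q ^ 2))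
      * (\<Sum>k. (qpoch q (q / a) (int k) * qpoch q (q / b) (int k) * qpoch q (q / c) (int k)
                 * qpoch q (d * e / q ^ 2) (int k))
              / (qpoch q q (int k) * qpoch q (q ^ 3 / (a * b * c)) (int k)
                 * qpoch q d (int k) * qpoch q e (int k)) * q ^ k)
   \<and>
   (\<Sum>\<^sub>\<infinity>k::int. (qpoch q (q / a) k * qpoch q (q / b) k * qpoch q (q / c) k
          * qpoch q (q / d) k * qpoch q (q / e) k)
        / (qpoch q a k * qpoch q b k * qpoch q c k * qpoch q (d / q) k * qpoch q (e / q) k)
        * (a * b * c * d * e / q ^ 4) powi k)
    = (qpoch_inf q q * qpoch_inf q (a * b / q) * qpoch_inf q (b * c / q) * qpoch_inf q (a * c / q))
        / (qpoch_inf q a * qpoch_inf q b * qpoch_inf q c * qpoch_inf q (a * b * c / q ^ 2))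
      * (\<Sum>k. (qpoch q (q / a) (int k) * qpoch q (q / b) (int k) * qpoch q (q / c) (int k)
                 * qpoch q (d * e / q ^ 2) (int k))
              / (qpoch q q (int k) * qpoch q (q ^ 3 / (a * b * c)) (int k)
                 * qpoch q d (int k) * qpoch q e (int k)) * q ^ (2 * k))"
proof -
  have q: "q \<noteq> 0" "cmod q < 1" using hq by auto
  have nz: "qp q a k \<noteq> 0" "qp q b k \<noteq> 0" "qp q c k \<noteq> 0" for k
    using wd_pos[of "int k"] by (auto simp: qpoch_nat)
  have nz': "qp q q k \<noteq> 0" "qp q d k \<noteq> 0" "qp q e k \<noteq> 0" "qp q (q ^ 3 / (a * b * c)) k \<noteq> 0" for k
    using wd_rhs[of k] by (auto simp: qpoch_nat)
  have uv: "d / q \<noteq> 1" "e / q \<noteq> 1"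
    using wd_pos[of 1] qpoch_nat[of q _ 1] by (auto simp: qp_def)
  \<comment> \<open>An exponent at least 1 is written \<open>Suc n\<close>; for the parameter x in
    question, q/x = q^(-n) and the sums end at n.\<close>
  obtain n where "a = q ^ Suc n \<or> b = q ^ Suc n \<or> c = q ^ Suc n"
    using hpow by (metis Suc_le_D One_nat_def)
  then have "transformation q a b c d e (q ^ 3) (\<lambda>k. q ^ k)
    \<and> transformation q a b c d e (q ^ 4) (\<lambda>k. q ^ (2 * k))"
  proof (elim disjE)
    assume a: "a = q ^ Suc n"
    show ?thesis
      unfolding a by (rule transformation_head) (use q hnz nz nz' uv wd_inf a in \<open>auto simp del: power_Suc\<close>)
  next
    assume b: "b = q ^ Suc n"
    show ?thesis
      unfolding transformation_swap(1)[of q a] unfolding b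
      by (rule transformation_head) (use q hnz nz nz' uv wd_inf b in \<open>auto simp: mult_ac simp del: power_Suc\<close>)
  next
    assume c: "c = q ^ Suc n"
    show ?thesis
      unfolding transformation_swap(2)[of q a] unfolding c
      by (rule transformation_head) (use q hnz nz nz' uv wd_inf c in \<open>auto simp: mult_ac simp del: power_Suc\<close>)
  qed
  then show ?thesis
    by (simp only: transformation_def bilateral_term_def[abs_def] qpoch_nat)
qed

end
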